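(* Let $X=[a,b]\subset\mathbb{R}^n$ be a box and let $f:\mathbb{R}^n\to\mathbb{R}$ be a non-convex twice continuously differentiable function. For any $\varepsilon>0$ there exist $t\in\mathbb{N}$ and a subdivision $\mathbf{Y}^t$ of $X$ satisfying $$\max_{k\in M_2(t)}\sum_{i=1}^n\alpha_i^{k}\left(\frac{b_i^{k}-a_i^{k}}{2}\right)^2\le\varepsilon$$ such that $\mathcal{X}_{op}^{\varepsilon}\subseteq\mathcal{X}_{ap}^{\varepsilon}(t)$.
   Context: A box is a set $[a,b]=\prod_{i=1}^n[a_i,b_i]$ with $a_i<b_i$. The approximate solution set is $\mathcal{X}_{op}^{\varepsilon}=\{x\in X: f(x)\le f(y)+\varepsilon\ \forall y\in X\}$. A subdivision $\mathbf{Y}^t=\{Y^1,\dots,Y^{M_t}\}$ of $X$ is a finite family of boxes $Y^{k}=[a^{k},b^{k}]=\prod_{i=1}^n[a_i^k,b_i^k]$ with $X=\bigcup_{k}Y^{k}$ and $Y^{k}\cap Y^{j}$ of Lebesgue measure zero in $\mathbb{R}^n$ for $k\neq j$; the index $t\in\mathbb{N}$ is the number of the division step. $M_t$ also denotes the index set $\{1,\dots,M_t\}$. For a box $Y=[a^Y,b^Y]$ and $d\in\mathbb{R}^n$ with positive entries put $$S(Y,i,d)=\sum_{j\neq i}\max\left\{\left|\min_{x\in Y}\nabla^2 f(x)_{ij}\right|,\left|\max_{x\in Y}\nabla^2 f(x)_{ij}\right|\right\}\frac{d_j}{d_i},$$ and $\tilde\lambda_Y=\min_{i}\left(\min_{x\in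 Y}\nabla^2 f(x)_{ii}-S(Y,i,\mathbf{1})\right)$ with $\mathbf{1}=(1,\dots,1)$. Index sets: $M_1(t)=\{k\in M_t:\tilde\lambda_{Y^k}\ge0\}$, $M_2(t)=\{k\in M_t:\tilde\lambda_{Y^k}<0\}$. A maximum over the empty set is $0$. The subdivisions are generated successively: $\mathbf{Y}^0=\{X\}$, and $\mathbf{Y}^{t+1}$ is obtained from $\mathbf{Y}^t$ by keeping each box with index in $M_1(t)$ and replacing each box with index in $M_2(t)$ by the two boxes obtained by halving it at the midpoint of its longest edge (the edge of smallest coordinate index if there are ties). Parameters: for $k\in M_t$, if $\tilde\lambda_{Y^k}\ge 0$ then $\alpha_i^k=0$ for all $i$; otherwise $\alpha_i^k=\max\left\{0,-\tfrac12\left(\min_{x\in Y^k}\nabla^2 f(x)_{ii}-S(Y^k,i,b^k-a^k)\right)\right\}$, $i=1,\dots,n$. Define on $Y^k$ $$F_k^{\alpha^k}(x)=f(x)+\sum_{i=1}^n\alpha_i^k(a_i^k-x_i)(b_i^k-x_i),$$ and, for $\delta>0$, $\mathcal{X}_{ap}^{k,\delta}=\{x\in Y^k: F_k^{\alpha^k}(x)\le F_k^{\alpha^k}(y)+\delta\ \forall y\in Y^k\}$. Put $\mathcal{X}_{ap}^{C\cup NC,\varepsilon}(t)=\bigcup_{k\in M_1(t)}\mathcal{X}_{ap}^{k,\varepsilon}\ \cup\ \bigcup_{k\in M_2(t)}\mathcal{X}_{ap}^{k,2\varepsilon}$ (quality $\varepsilon$ on the $M_1$ boxes and $2\varepsilon$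 on the $M_2$ boxes). The approximate solution set of the piecewise convexification problem is $$\mathcal{X}_{ap}^{\varepsilon}(t)=\{x\in\mathcal{X}_{ap}^{C\cup NC,\varepsilon}(t): f(x)\le f(y)+\varepsilon\ \forall y\in\mathcal{X}_{ap}^{C\cup NC,\varepsilon}(t)\}.$$ *)

theory Defs
  imports "HOL-Analysis.Analysis"
begin

definition gradient :: "(real^'n \<Rightarrow> real) \<Rightarrow> real^'n \<Rightarrow> real^'n"
  where "gradient f x = (\<chi> i. frechet_derivative f (at x) (axis i 1))"

definition hessian :: "(real^'n \<Rightarrow> real) \<Rightarrow> real^'n \<Rightarrow> real^'n^'n"
  where "hessian f x = jacobian (gradient f) (at x)"

definition twice_continuously_differentiable :: "(real^'n \<Rightarrow> real) \<Rightarrow> bool"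
  where "twice_continuously_differentiable f \<longleftrightarrow>
    f differentiable_on UNIV \<and> gradient f differentiable_on UNIV \<and> continuous_on UNIV (hessian f)"

text \<open>
  Minimum and maximum of a function over a set.  They are only meaningful when they are attained;
  below they are only taken of continuous functions over compact boxes.
\<close>

definition min_over :: "('a \<Rightarrow> real) \<Rightarrow> 'a set \<Rightarrow> real"
  where "min_over g A = (LEAST m. m \<in> g ` A)"

definition max_over :: "('a \<Rightarrow> real) \<Rightarrow> 'a set \<Rightarrow> real"
  where "max_over g A = (GREATEST m. m \<in> g ` A)"

definition Max_or_0 :: "real set \<Rightarrow> real"
  where "Max_or_0 A = (if A = {} then 0 else Max A)"

text \<open>
  A box is represented by the pair of its lower and upper corners.  The components of vectors are
  indexed by a finite linearly ordered type, because ties between longest edges are resolved by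
  the order of the coordinates.
\<close>

type_synonym 'n box = "(real^'n) \<times> (real^'n)"

definition is_box :: "'n::finite box \<Rightarrow> bool"
  where "is_box Y \<longleftrightarrow> (\<forall>i. fst Y $ i < snd Y $ i)"

definition box_set :: "'n::finite box \<Rightarrow> (real^'n) set"
  where "box_set Y = cbox (fst Y) (snd Y)"

text \<open>
  A finite family of boxes is a list, so the index set of the family is \<open>{..<length Ys}\<close>
  (counting from \<open>0\<close>).
\<close>

definition is_subdivision :: "'n::finite box list \<Rightarrow> (real^'n) set \<Rightarrow> bool"
  where "is_subdivision Ys X \<longleftrightarrow>
    (\<forall>k<length Ys. is_box (Ys ! k)) \<and>
    X = (\<Union>k<length Ys. box_set (Ys ! k)) \<and>
    (\<forall>k<length Ys. \<forall>j<length Ys. k \<noteq> j \<longrightarrow>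
       box_set (Ys ! k) \<inter> box_set (Ys ! j) \<in> null_sets lebesgue)"

definition S_off :: "(real^'n \<Rightarrow> real) \<Rightarrow> 'n::finite box \<Rightarrow> 'n \<Rightarrow> real^'n \<Rightarrow> real"
  where "S_off f Y i d = (\<Sum>j\<in>UNIV - {i}.
    max \<bar>min_over (\<lambda>x. hessian f x $ i $ j) (box_set Y)\<bar>
        \<bar>max_over (\<lambda>x. hessian f x $ i $ j) (box_set Y)\<bar> * (d $ j / d $ i))"

definition lambda_tilde :: "(real^'n \<Rightarrow> real) \<Rightarrow> 'n::finite box \<Rightarrow> real"
  where "lambda_tilde f Y =
    Min (range (\<lambda>i. min_over (\<lambda>x. hessian f x $ i $ i) (box_set Y) - S_off f Y i 1))"

definition M1 :: "(real^'n \<Rightarrow> real) \<Rightarrow> 'n::finite box list \<Rightarrow> nat set"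
  where "M1 f Ys = {k. k < length Ys \<and> lambda_tilde f (Ys ! k) \<ge> 0}"

definition M2 :: "(real^'n \<Rightarrow> real) \<Rightarrow> 'n::finite box list \<Rightarrow> nat set"
  where "M2 f Ys = {k. k < length Ys \<and> lambda_tilde f (Ys ! k) < 0}"

definition longest_edge :: "'n::{finite,linorder} box \<Rightarrow> 'n"
  where "longest_edge Y = Min {i. \<forall>j. snd Y $ j - fst Y $ j \<le> snd Y $ i - fst Y $ i}"

definition bisect :: "'n::{finite,linorder} box \<Rightarrow> 'n box list"
  where "bisect Y =
    (let l = longest_edge Y; c = (fst Y $ l + snd Y $ l) / 2 in
      [(fst Y, \<chi> i. if i = l then c else snd Y $ i),
       (\<chi> i. if i = l then c else fst Y $ i, snd Y)])"

primrec subdivision ::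
  "(real^'n::{finite,linorder} \<Rightarrow> real) \<Rightarrow> 'n box \<Rightarrow> nat \<Rightarrow> 'n box list"
  where
    "subdivision f X 0 = [X]"
  | "subdivision f X (Suc t) =
       concat (map (\<lambda>Y. if lambda_tilde f Y \<ge> 0 then [Y] else bisect Y) (subdivision f X t))"

definition alpha :: "(real^'n \<Rightarrow> real) \<Rightarrow> 'n::finite box \<Rightarrow> 'n \<Rightarrow> real"
  where "alpha f Y i =
    (if lambda_tilde f Y \<ge> 0 then 0
     else max 0 (- (1/2) * (min_over (\<lambda>x. hessian f x $ i $ i) (box_set Y)
                            - S_off f Y i (snd Y - fst Y))))"

definition F_conv :: "(real^'n \<Rightarrow> real) \<Rightarrow> 'n::finite box \<Rightarrow> real^'n \<Rightarrow> real"
  where "F_conv f Y x =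
    f x + (\<Sum>i\<in>UNIV. alpha f Y i * (fst Y $ i - x $ i) * (snd Y $ i - x $ i))"

definition approx_solutions :: "('a \<Rightarrow> real) \<Rightarrow> 'a set \<Rightarrow> real \<Rightarrow> 'a set"
  where "approx_solutions g A \<delta> = {x \<in> A. \<forall>y\<in>A. g x \<le> g y + \<delta>}"

definition X_op :: "(real^'n \<Rightarrow> real) \<Rightarrow> (real^'n) set \<Rightarrow> real \<Rightarrow> (real^'n) set"
  where "X_op f X \<epsilon> = approx_solutions f X \<epsilon>"

definition X_ap_box :: "(real^'n \<Rightarrow> real) \<Rightarrow> 'n::finite box \<Rightarrow> real \<Rightarrow> (real^'n) set"
  where "X_ap_box f Y \<delta> = approx_solutions (F_conv f Y) (box_set Y) \<delta>"

definition X_ap_CNC :: "(real^'n \<Rightarrow> real) \<Rightarrow> 'n::finite box list \<Rightarrow> real \<Rightarrow> (real^'n) set"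
  where "X_ap_CNC f Ys \<epsilon> =
    (\<Union>k\<in>M1 f Ys. X_ap_box f (Ys ! k) \<epsilon>) \<union> (\<Union>k\<in>M2 f Ys. X_ap_box f (Ys ! k) (2 * \<epsilon>))"

definition X_ap :: "(real^'n \<Rightarrow> real) \<Rightarrow> 'n::finite box list \<Rightarrow> real \<Rightarrow> (real^'n) set"
  where "X_ap f Ys \<epsilon> = approx_solutions f (X_ap_CNC f Ys \<epsilon>) \<epsilon>"

end

theory Submission
  imports Defs
begin

text \<open>
  The term added to \<open>f\<close> on a box \<open>Y\<close> lies between
  \<open>- (\<Sum>i. \<alpha>\<^sub>i * ((b\<^sub>i - a\<^sub>i) / 2)\<^sup>2)\<close> and \<open>0\<close>, so once that sum is at most \<open>\<epsilon>\<close>, every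
  \<open>\<epsilon>\<close>-solution of \<open>f\<close> in \<open>Y\<close> is a \<open>2\<epsilon>\<close>-solution of the convexified problem.
  With the entries of the Hessian bounded on \<open>X\<close>, the sum is
  \<open>O(\<delta>\<^sup>2)\<close> for a box whose edges have length at most \<open>\<delta>\<close>: the weights \<open>d\<^sub>j / d\<^sub>i\<close> in \<open>\<alpha>\<^sub>i\<close> are
  multiplied by \<open>d\<^sub>i\<^sup>2\<close>, so the shape of the box does not matter.  Finally, a box that is still
  in \<open>M\<^sub>2\<close> at step \<open>t\<close> has been bisected \<open>t\<close> times, and as long as its longest edge exceeds \<open>\<delta>\<close>
  every bisection decreases the sum of its edges by at least \<open>\<delta>/2\<close>.
\<close>

section \<open>Bisection of boxes\<close>

text \<open>\<open>longest_edge\<close> is a \<open>Min\<close> over a set of indices, so it says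
  something only if that set is nonempty. An index attaining \<open>Max (range ?d)\<close> belongs
  to it.\<close>

lemma edge_le_longest_edge:
  fixes Y :: "'n::{finite,linorder} box"
  shows "snd Y $ j - fst Y $ j \<le> snd Y $ longest_edge Y - fst Y $ longest_edge Y"
proof -
  let ?d = "\<lambda>i. snd Y $ i - fst Y $ i"
  let ?L = "{i. \<forall>j. ?d j \<le> ?d i}"
  have "Max (range ?d) \<in> range ?d"
    by (rule Max_in) auto
  then obtain i where i: "Max (range ?d) = ?d i"
    by (rule imageE)
  have "?d j \<le> ?d i" for j
    unfolding i[symmetric] by (rule Max_ge) auto
  then have "i \<in> ?L"
    by blast
  then have "longest_edge Y \<in> ?L"
    unfolding longest_edge_def by (intro Min_in) auto
  then show ?thesis
    by blast
qed

lemma is_box_bisect: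
  assumes "is_box Y" and "Z \<in> set (bisect Y)"
  shows "is_box Z"
  using assms by (auto simp: bisect_def Let_def is_box_def field_simps add_strict_mono)

lemma edge_bisect:
  assumes "Z \<in> set (bisect Y)"
  shows "snd Z $ i - fst Z $ i =
    (if i = longest_edge Y then (snd Y $ i - fst Y $ i) / 2 else snd Y $ i - fst Y $ i)"
  using assms by (auto simp: bisect_def Let_def field_simps)

lemma box_set_bisect:
  assumes "is_box Y"
  shows "(\<Union>Z\<in>set (bisect Y). box_set Z) = box_set Y"
proof -
  define l where "l = longest_edge Y"
  define c where "c = (fst Y $ l + snd Y $ l) / 2"
  have c: "fst Y $ l \<le> c" "c \<le> snd Y $ l"
    using assms[unfolded is_box_def, rule_format, of l] by (auto simp: c_def)
  have "x \<in> (\<Union>Z\<in>set (bisect Y). box_set Z) \<longleftrightarrow> x \<in> box_set Y" for x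
  proof -
    \<comment> \<open>Since c lies between the corners in coordinate l, replacing one bound by c
      amounts to adding one half-space constraint.\<close>
    have "x \<in> box_set (fst Y, \<chi> i. if i = l then c else snd Y $ i) \<longleftrightarrow> x \<in> box_set Y \<and> x $ l \<le> c"
      using c by (simp add: box_set_def mem_box_cart) (smt (verit))
    moreover have "x \<in> box_set (\<chi> i. if i = l then c else fst Y $ i, snd Y) \<longleftrightarrow> x \<in> box_set Y \<and> c \<le> x $ l"
      using c by (simp add: box_set_def mem_box_cart) (smt (verit))
    ultimately show ?thesis
      unfolding bisect_def Let_def l_def[symmetric] c_def[symmetric] by auto
  qed
  then show ?thesis
    by blast
qed

text \<open>The two halves meet only inside the hyperplane \<open>x $ l = c\<close>, which has
  measure zero.\<close>

lemma sorted_wrt_bisect: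
  "sorted_wrt (\<lambda>A B. negligible (box_set A \<inter> box_set B)) (bisect Y)"
proof -
  define l where "l = longest_edge Y"
  define c where "c = (fst Y $ l + snd Y $ l) / 2"
  have "box_set (fst Y, \<chi> i. if i = l then c else snd Y $ i) \<inter>
      box_set (\<chi> i. if i = l then c else fst Y $ i, snd Y) \<subseteq> {x. x $ l = c}"
  proof (intro subsetI CollectI antisym; elim IntE)
    show "x $ l \<le> c" if "x \<in> box_set (fst Y, \<chi> i. if i = l then c else snd Y $ i)" for x
      using that by (auto simp: box_set_def mem_box_cart dest!: spec[of _ l])
    show "c \<le> x $ l" if "x \<in> box_set (\<chi> i. if i = l then c else fst Y $ i, snd Y)" for x
      using that by (auto simp: box_set_def mem_box_cart dest!: spec[of _ l])
  qed
  moreover have "negligible {x. x $ l = c}"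
    using negligible_standard_hyperplane[of "axis l (1::real)" c] by (simp add: inner_axis)
  ultimately have "negligible (box_set (fst Y, \<chi> i. if i = l then c else snd Y $ i) \<inter>
      box_set (\<chi> i. if i = l then c else fst Y $ i, snd Y))"
    using negligible_subset by blast
  then show ?thesis
    unfolding bisect_def Let_def l_def[symmetric] c_def[symmetric] by simp
qed

section \<open>The generated subdivisions\<close>

text \<open>Serves one refinement step: \<open>g\<close> replaces a box by its parts, and the last
  assumption says that parts of different boxes inherit the relation.\<close>

lemma sorted_wrt_concat_map:
  assumes "sorted_wrt P xs"
    and "\<And>x. x \<in> set xs \<Longrightarrow> sorted_wrt P (g x)"
    and "\<And>x y u v. x \<in> set xs \<Longrightarrow> y \<in> set xs \<Longrightarrow> P x y \<Longrightarrow> u \<in> set (g x) \<Longrightarrow> v \<in> set (g y) \<Longrightarrow> P u v"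
  shows "sorted_wrt P (concat (map g xs))"
  using assms
proof (induction xs)
  case (Cons x xs)
  have "P u v" if u: "u \<in> set (g x)" and v: "v \<in> set (concat (map g xs))" for u v
  proof -
    obtain y where y: "y \<in> set xs" "v \<in> set (g y)"
      using v by auto
    then show ?thesis
      using Cons.prems(1) u by (auto intro!: Cons.prems(3)[of x y u v])
  qed
  moreover have "sorted_wrt P (concat (map g xs))"
  proof (rule Cons.IH)
    show "P u v" if "y \<in> set xs" "z \<in> set xs" "P y z" "u \<in> set (g y)" "v \<in> set (g z)" for y z u v
      using Cons.prems(3)[of y z u v] that by simp
  qed (use Cons.prems in auto)
  ultimately show ?case
    using Cons.prems(2) by (auto simp: sorted_wrt_append)
qed simp

text \<open>The overlap condition is symmetric, so the pairs with k < j suffice. This form avoids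
  index arithmetic when lists are concatenated.\<close>

lemma is_subdivision_iff_sorted_wrt:
  "is_subdivision Ys X \<longleftrightarrow>
    (\<forall>Y\<in>set Ys. is_box Y) \<and> (\<Union>Y\<in>set Ys. box_set Y) = X \<and>
    sorted_wrt (\<lambda>A B. negligible (box_set A \<inter> box_set B)) Ys"
proof -
  let ?P = "\<lambda>k j. box_set (Ys ! k) \<inter> box_set (Ys ! j) \<in> null_sets lebesgue"
  have sym: "?P k j \<longleftrightarrow> ?P j k" for k j
    by (simp only: Int_commute)
  have "(\<forall>k<length Ys. \<forall>j<length Ys. k \<noteq> j \<longrightarrow> ?P k j) \<longleftrightarrow>
    (\<forall>k j. k < j \<longrightarrow> j < length Ys \<longrightarrow> ?P k j)"
  proof (intro iffI allI impI)
    fix k j assume "\<forall>k j. k < j \<longrightarrow> j < length Ys \<longrightarrow> ?P k j" "k < length Ys" "j < length Ys" "k \<noteq> j"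
    then show "?P k j"
      using sym[of k j] by (cases k j rule: linorder_cases) blast+
  qed auto
  then have "(\<forall>k<length Ys. \<forall>j<length Ys. k \<noteq> j \<longrightarrow> ?P k j) \<longleftrightarrow>
    sorted_wrt (\<lambda>A B. negligible (box_set A \<inter> box_set B)) Ys"
    by (simp only: sorted_wrt_iff_nth_less negligible_iff_null_sets)
  moreover have "(\<Union>k<length Ys. box_set (Ys ! k)) = (\<Union>Y\<in>set Ys. box_set Y)"
    by (auto simp: set_conv_nth)
  ultimately show ?thesis
    unfolding is_subdivision_def by (auto simp: all_set_conv_all_nth)
qed

lemma is_subdivision_subdivision:
  assumes "is_box X"
  shows "is_subdivision (subdivision f X t) (box_set X)"
proof (induction t)
  case 0
  then show ?case
    using assms by (simp add: is_subdivision_iff_sorted_wrt)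
next
  case (Suc t)
  define g where "g = (\<lambda>Y. if lambda_tilde f Y \<ge> 0 then [Y] else bisect Y)"
  let ?Ys = "subdivision f X t"
  let ?P = "\<lambda>A B. negligible (box_set A \<inter> box_set B)"
  have IH: "\<And>Y. Y \<in> set ?Ys \<Longrightarrow> is_box Y" "(\<Union>Y\<in>set ?Ys. box_set Y) = box_set X" "sorted_wrt ?P ?Ys"
    using Suc by (auto simp: is_subdivision_iff_sorted_wrt)
  have union: "(\<Union>Z\<in>set (g Y). box_set Z) = box_set Y" if "Y \<in> set ?Ys" for Y
    using box_set_bisect[OF IH(1)[OF that]] by (simp add: g_def)
  have "sorted_wrt ?P (concat (map g ?Ys))"
  proof (rule sorted_wrt_concat_map[OF IH(3)])
    show "sorted_wrt ?P (g Y)" for Y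
      by (simp add: g_def sorted_wrt_bisect)
    \<comment> \<open>Each part lies in its parent, so the overlap of parts stays inside the
      negligible overlap of the parents.\<close>
    show "?P U V" if "Y \<in> set ?Ys" "Z \<in> set ?Ys" "?P Y Z" "U \<in> set (g Y)" "V \<in> set (g Z)" for Y Z U V
    proof (rule negligible_subset[OF that(3)])
      show "box_set U \<inter> box_set V \<subseteq> box_set Y \<inter> box_set Z"
        using union[OF that(1)] union[OF that(2)] that(4,5) by blast
    qed
  qed
  moreover have "\<forall>Z\<in>set (concat (map g ?Ys)). is_box Z"
    using IH(1) is_box_bisect by (fastforce simp: g_def split: if_splits)
  moreover have "(\<Union>Z\<in>set (concat (map g ?Ys)). box_set Z) = box_set X"
    using union IH(2) by auto
  ultimately show ?case
    by (simp add: is_subdivision_iff_sorted_wrt g_def)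
qed

section \<open>Edge lengths of the boxes remaining in \<open>M2\<close>\<close>

lemma edge_M2_subdivision:
  assumes "is_box X" and "\<delta> > 0" and "Z \<in> set (subdivision f X t)" and "lambda_tilde f Z < 0"
  shows "(\<forall>i. snd Z $ i - fst Z $ i \<le> \<delta>) \<or>
    (\<Sum>i\<in>UNIV. snd Z $ i - fst Z $ i) \<le> (\<Sum>i\<in>UNIV. snd X $ i - fst X $ i) - real t * (\<delta> / 2)"
  using assms(3,4)
proof (induction t arbitrary: Z)
  case (Suc t)
  \<comment> \<open>A kept box has \<open>lambda_tilde\<close> at least 0, so Z must be a half of a
    box Y that was itself in \<open>M2\<close>; the induction hypothesis therefore applies to
    Y.\<close>
  obtain Y where Y: "Y \<in> set (subdivision f X t)" "lambda_tilde f Y < 0" "Z \<in> set (bisect Y)"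
    using Suc.prems by (auto split: if_splits)
  let ?d = "\<lambda>Y i. snd Y $ i - fst Y $ i"
  let ?l = "longest_edge Y"
  have edge: "?d Z i = ?d Y i - (if i = ?l then ?d Y i / 2 else 0)" for i
    using edge_bisect[OF Y(3), of i] by (simp add: field_simps)
  have "is_box Y"
    using is_subdivision_subdivision[OF assms(1), of f t] Y(1) by (auto simp: is_subdivision_iff_sorted_wrt)
  then have pos: "?d Y i > 0" for i
    by (simp add: is_box_def)
  show ?case
  proof (cases "?d Y ?l \<le> \<delta>")
    case True
    have "?d Z i \<le> \<delta>" for i
      using edge_le_longest_edge[of Y i] True pos[of i] edge[of i]
      by (auto simp: diff_divide_distrib split: if_splits)
    then show ?thesis
      by blast
  next
    \<comment> \<open>The longest edge of Y exceeds \<delta>, which rules out the first alternative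
      for Y; halving that edge then removes more than \<delta>/2 from the sum.\<close>
    case False
    then have "(\<Sum>i\<in>UNIV. ?d Y i) \<le> (\<Sum>i\<in>UNIV. ?d X i) - real t * (\<delta> / 2)"
      using Suc.IH[OF Y(1,2)] by blast
    moreover have "(\<Sum>i\<in>UNIV. ?d Z i) = (\<Sum>i\<in>UNIV. ?d Y i) - ?d Y ?l / 2"
      by (subst edge) (simp only: sum_subtractf[of "?d Y"] sum.delta finite UNIV_I if_True)
    ultimately have "(\<Sum>i\<in>UNIV. ?d Z i) \<le> (\<Sum>i\<in>UNIV. ?d X i) - real t * (\<delta> / 2) - \<delta> / 2"
      using False unfolding diff_divide_distrib by linarith
    then show ?thesis
      by (simp add: algebra_simps add_divide_distrib)
  qed
qed simp

lemma exists_step_small_edges: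
  assumes "is_box X" and "\<delta> > 0"
  shows "\<exists>t. \<forall>Z\<in>set (subdivision f X t). lambda_tilde f Z < 0 \<longrightarrow> (\<forall>i. snd Z $ i - fst Z $ i \<le> \<delta>)"
proof -
  let ?s = "\<lambda>Z. \<Sum>i\<in>UNIV. snd Z $ i - fst Z $ i"
  \<comment> \<open>For this t the second alternative of \<open>edge_M2_subdivision\<close> would
    make the sum of the edges negative.\<close>
  obtain t where t: "?s X < real t * (\<delta> / 2)"
    using reals_Archimedean3[of "\<delta> / 2"] assms(2) by auto
  have "?s Z \<ge> 0" if "Z \<in> set (subdivision f X t)" for Z
  proof -
    have "is_box Z"
      using is_subdivision_subdivision[OF assms(1), of f t] that by (simp add: is_subdivision_iff_sorted_wrt)
    then show ?thesis
      by (intro sum_nonneg) (simp add: is_box_def less_imp_le)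
  qed
  then have "\<forall>Z\<in>set (subdivision f X t). lambda_tilde f Z < 0 \<longrightarrow> (\<forall>i. snd Z $ i - fst Z $ i \<le> \<delta>)"
    using edge_M2_subdivision[OF assms, of _ f t] t by fastforce
  then show ?thesis
    by blast
qed

section \<open>Bounds on the convexification\<close>

text \<open>Compactness makes the \<open>LEAST\<close> exist; only then do bounds on
  \<open>g\<close> pass to \<open>min_over g A\<close>.\<close>

lemma min_over_mem:
  assumes "compact A" and "A \<noteq> {}" and "continuous_on A g"
  shows "min_over g A \<in> g ` A"
proof -
  obtain x where x: "x \<in> A" "\<forall>y\<in>A. g x \<le> g y"
    using continuous_attains_inf[OF assms] by blast
  then have "min_over g A = g x"
    unfolding min_over_def by (intro Least_equality) auto
  then show ?thesis
    using x by simp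
qed

lemma max_over_mem:
  assumes "compact A" and "A \<noteq> {}" and "continuous_on A g"
  shows "max_over g A \<in> g ` A"
proof -
  obtain x where x: "x \<in> A" "\<forall>y\<in>A. g y \<le> g x"
    using continuous_attains_sup[OF assms] by blast
  then have "max_over g A = g x"
    unfolding max_over_def by (intro Greatest_equality) auto
  then show ?thesis
    using x by simp
qed

lemma alpha_nonneg: "alpha f Y i \<ge> 0"
  by (simp add: alpha_def)

lemma sum_alpha_le:
  fixes f :: "real^'n::finite \<Rightarrow> real"
  assumes "is_box Y" and cont: "continuous_on UNIV (hessian f)"
    and C: "\<And>x i j. x \<in> box_set Y \<Longrightarrow> \<bar>hessian f x $ i $ j\<bar> \<le> C"
    and small: "\<And>i. snd Y $ i - fst Y $ i \<le> \<delta>"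
  shows "(\<Sum>i\<in>UNIV. alpha f Y i * ((snd Y $ i - fst Y $ i) / 2)^2) \<le> (real CARD('n))\<^sup>2 * C * \<delta>\<^sup>2"
proof -
  define d where "d = snd Y - fst Y"
  have d: "0 < d $ i" "d $ i \<le> \<delta>" for i
    using assms(1) small[of i] by (auto simp: d_def is_box_def)
  have box: "compact (box_set Y)" "box_set Y \<noteq> {}"
    using assms(1) by (auto simp: box_set_def is_box_def interval_ne_empty_cart less_imp_le)
  have cont': "continuous_on (box_set Y) (\<lambda>x. hessian f x $ i $ j)" for i j
    by (intro continuous_intros continuous_on_subset[OF cont]) auto
  have minb: "\<bar>min_over (\<lambda>x. hessian f x $ i $ j) (box_set Y)\<bar> \<le> C" for i j
    using min_over_mem[OF box cont'[of i j]] C by force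
  have maxb: "\<bar>max_over (\<lambda>x. hessian f x $ i $ j) (box_set Y)\<bar> \<le> C" for i j
    using max_over_mem[OF box cont'[of i j]] C by force
  have C0: "0 \<le> C"
    using minb abs_ge_zero order_trans by blast
  have "alpha f Y i * ((snd Y $ i - fst Y $ i) / 2)^2 \<le> real CARD('n) * C * \<delta>\<^sup>2" for i
  proof -
    have "S_off f Y i d \<le> (\<Sum>j\<in>UNIV - {i}. C * (d $ j / d $ i))"
      unfolding S_off_def using minb maxb d(1)
      by (intro sum_mono mult_right_mono) (auto simp: less_imp_le)
    moreover have "0 \<le> S_off f Y i d"
      unfolding S_off_def using d(1)
      by (intro sum_nonneg mult_nonneg_nonneg) (auto simp: less_imp_le)
    moreover have "- C \<le> min_over (\<lambda>x. hessian f x $ i $ i) (box_set Y)"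
      using minb[of i i] by linarith
    \<comment> \<open>The factor 1/2 is given away. The second inequality covers the 0 inside the
      \<open>max\<close> of \<open>alpha\<close> and its value 0 on \<open>M1\<close> boxes.\<close>
    ultimately have "- (1/2) * (min_over (\<lambda>x. hessian f x $ i $ i) (box_set Y) - S_off f Y i d) \<le>
        C + (\<Sum>j\<in>UNIV - {i}. C * (d $ j / d $ i))" "0 \<le> C + (\<Sum>j\<in>UNIV - {i}. C * (d $ j / d $ i))"
      using C0 unfolding right_diff_distrib[of "- (1/2)"] by linarith+
    then have "alpha f Y i \<le> C + (\<Sum>j\<in>UNIV - {i}. C * (d $ j / d $ i))"
      unfolding alpha_def d_def[symmetric] by (simp only: max.bounded_iff split: if_split) simp
    \<comment> \<open>The diagonal bound C is the missing summand j = i, whose weight is 1.\<close>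
    also have "\<dots> = (\<Sum>j\<in>UNIV. C * (d $ j / d $ i))"
      using d(1)[of i] by (subst sum.remove[of UNIV i]) auto
    finally have "alpha f Y i * (d $ i)\<^sup>2 \<le> (\<Sum>j\<in>UNIV. C * (d $ j / d $ i)) * (d $ i)\<^sup>2"
      by (rule mult_right_mono) simp
    also have "\<dots> = (\<Sum>j\<in>UNIV. C * (d $ j * d $ i))"
      unfolding sum_distrib_right using d(1)[of i]
      by (intro sum.cong refl) (simp add: power2_eq_square)
    also have "\<dots> \<le> (\<Sum>j\<in>(UNIV :: 'n set). C * \<delta>\<^sup>2)"
      unfolding power2_eq_square using C0 d(2) less_imp_le[OF d(1)] order_trans[OF less_imp_le[OF d(1)] d(2)]
      by (intro sum_mono mult_left_mono mult_mono) auto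
    finally have "alpha f Y i * (d $ i)\<^sup>2 \<le> real CARD('n) * C * \<delta>\<^sup>2"
      by simp
    \<comment> \<open>The factor 1/4 is given away as well.\<close>
    moreover have "alpha f Y i * (d $ i / 2)\<^sup>2 \<le> alpha f Y i * (d $ i)\<^sup>2"
      using d(1)[of i] alpha_nonneg[of f Y i] by (intro mult_left_mono power_mono) auto
    ultimately show ?thesis
      by (simp add: d_def)
  qed
  then have "(\<Sum>i\<in>UNIV. alpha f Y i * ((snd Y $ i - fst Y $ i) / 2)^2) \<le>
      (\<Sum>i\<in>(UNIV :: 'n set). real CARD('n) * C * \<delta>\<^sup>2)"
    by (rule sum_mono)
  then show ?thesis
    by (simp add: power2_eq_square mult.assoc)
qed

text \<open>Inside the box the factors \<open>fst Y $ i - x $ i\<close> and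
  \<open>snd Y $ i - x $ i\<close> have opposite signs.\<close>

lemma F_conv_le:
  assumes "x \<in> box_set Y"
  shows "F_conv f Y x \<le> f x"
proof -
  have "(\<Sum>i\<in>UNIV. alpha f Y i * (fst Y $ i - x $ i) * (snd Y $ i - x $ i)) \<le> 0"
    using assms
    by (intro sum_nonpos mult_nonpos_nonneg[OF mult_nonneg_nonpos] alpha_nonneg) (auto simp: box_set_def mem_box_cart)
  then show ?thesis
    by (simp add: F_conv_def)
qed

text \<open>By completing the square, each product is smallest at the midpoint of its edge; hence x
  may be any point, inside the box or not.\<close>

lemma le_F_conv:
  "f x \<le> F_conv f Y x + (\<Sum>i\<in>UNIV. alpha f Y i * ((snd Y $ i - fst Y $ i) / 2)^2)"
proof -
  have "0 \<le> (u - x) * (v - x) + ((v - u) / 2)\<^sup>2" for u v x :: real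
  proof -
    have "(u - x) * (v - x) + ((v - u) / 2)\<^sup>2 = (x - (u + v) / 2)\<^sup>2"
      by (simp add: power2_eq_square field_simps)
    then show ?thesis
      by simp
  qed
  then have "0 \<le> (\<Sum>i\<in>UNIV. alpha f Y i *
      ((fst Y $ i - x $ i) * (snd Y $ i - x $ i) + ((snd Y $ i - fst Y $ i) / 2)^2))"
    by (intro sum_nonneg mult_nonneg_nonneg alpha_nonneg)
  then show ?thesis
    by (simp add: F_conv_def distrib_left sum.distrib mult.assoc)
qed

section \<open>Inclusion of the solution sets\<close>

lemma X_op_subset_X_ap:
  assumes "is_subdivision Ys X"
    and small: "\<And>k. k \<in> M2 f Ys \<Longrightarrow>
      (\<Sum>i\<in>UNIV. alpha f (Ys ! k) i * ((snd (Ys ! k) $ i - fst (Ys ! k) $ i) / 2)^2) \<le> \<epsilon>"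
  shows "X_op f X \<epsilon> \<subseteq> X_ap f Ys \<epsilon>"
proof
  fix x assume "x \<in> X_op f X \<epsilon>"
  then have x: "x \<in> X" and opt: "\<And>y. y \<in> X \<Longrightarrow> f x \<le> f y + \<epsilon>"
    by (auto simp: X_op_def approx_solutions_def)
  have X: "X = (\<Union>k<length Ys. box_set (Ys ! k))"
    using assms(1) by (auto simp: is_subdivision_def)
  then obtain k where k: "k < length Ys" "x \<in> box_set (Ys ! k)"
    using x by auto
  have opt_k: "f x \<le> f y + \<epsilon>" if "y \<in> box_set (Ys ! k)" for y
    using opt that k(1) X by blast
  have "x \<in> X_ap_CNC f Ys \<epsilon>"
  proof (cases "lambda_tilde f (Ys ! k) \<ge> 0")
    case True
    then have "F_conv f (Ys ! k) = f"
      by (simp add: fun_eq_iff F_conv_def alpha_def)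
    then have "x \<in> X_ap_box f (Ys ! k) \<epsilon>"
      using k(2) opt_k by (simp add: X_ap_box_def approx_solutions_def)
    then show ?thesis
      using True k(1) by (auto simp: X_ap_CNC_def M1_def)
  next
    case False
    then have k2: "k \<in> M2 f Ys"
      using k(1) by (simp add: M2_def)
    \<comment> \<open>The chain is F(x) \<le> f(x) \<le> f(y) + \<epsilon> \<le> F(y) + 2\<epsilon>:
      one \<epsilon> from optimality, one from the convexification gap.\<close>
    have "F_conv f (Ys ! k) x \<le> F_conv f (Ys ! k) y + 2 * \<epsilon>" if "y \<in> box_set (Ys ! k)" for y
      using F_conv_le[OF k(2), of f] opt_k[OF that] le_F_conv[of f y "Ys ! k"] small[OF k2] by linarith
    then have "x \<in> X_ap_box f (Ys ! k) (2 * \<epsilon>)"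
      using k(2) by (simp add: X_ap_box_def approx_solutions_def)
    then show ?thesis
      using k2 by (auto simp: X_ap_CNC_def)
  qed
  \<comment> \<open>All competitors in the final selection lie in X, where x is already
    \<epsilon>-optimal.\<close>
  moreover have "X_ap_CNC f Ys \<epsilon> \<subseteq> X"
    using X by (auto simp: X_ap_CNC_def X_ap_box_def approx_solutions_def M1_def M2_def)
  ultimately show "x \<in> X_ap f Ys \<epsilon>"
    using opt by (auto simp: X_ap_def approx_solutions_def)
qed

theorem theorem3p4:
  fixes f :: "real^'n::{finite,linorder} \<Rightarrow> real"
    and a b :: "real^'n::{finite,linorder}"
    and \<epsilon> :: real
  assumes "is_box (a, b)"
    and "twice_continuously_differentiable f"
    and "\<not> convex_on UNIV f"
    and "\<epsilon> > 0"
  shows "\<exists>t Ys. Ys = subdivision f (a, b) t \<and>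
    is_subdivision Ys (box_set (a, b)) \<and>
    Max_or_0 ((\<lambda>k. \<Sum>i\<in>UNIV. alpha f (Ys ! k) i *
      ((snd (Ys ! k) $ i - fst (Ys ! k) $ i) / 2)^2) ` M2 f Ys) \<le> \<epsilon> \<and>
    X_op f (box_set (a, b)) \<epsilon> \<subseteq> X_ap f Ys \<epsilon>"
proof -
  have cont: "continuous_on UNIV (hessian f)"
    using assms(2) by (simp add: twice_continuously_differentiable_def)
  have "compact (hessian f ` box_set (a, b))"
    by (intro compact_continuous_image continuous_on_subset[OF cont]) (auto simp: box_set_def)
  then obtain C where C: "C > 0" "\<And>x. x \<in> box_set (a, b) \<Longrightarrow> norm (hessian f x) \<le> C"
    using compact_imp_bounded bounded_pos by (metis imageI)
  have hess: "\<bar>hessian f x $ i $ j\<bar> \<le> C" if "x \<in> box_set (a, b)" for x i j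
    using C(2)[OF that] Finite_Cartesian_Product.norm_nth_le[of "hessian f x" i]
      Finite_Cartesian_Product.norm_nth_le[of "hessian f x $ i" j] by simp
  \<comment> \<open>Chosen so that the bound of \<open>sum_alpha_le\<close> becomes exactly
    \<epsilon>; C > 0 makes the division legitimate.\<close>
  define \<delta> where "\<delta> = sqrt (\<epsilon> / ((real CARD('n))\<^sup>2 * C))"
  have \<delta>: "\<delta> > 0" "(real CARD('n))\<^sup>2 * C * \<delta>\<^sup>2 = \<epsilon>"
    using C(1) assms(4) by (auto simp: \<delta>_def)
  obtain t where t: "\<And>Z i. Z \<in> set (subdivision f (a, b) t) \<Longrightarrow> lambda_tilde f Z < 0 \<Longrightarrow>
      snd Z $ i - fst Z $ i \<le> \<delta>"
    using exists_step_small_edges[OF assms(1) \<delta>(1)] by blast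
  define Ys where "Ys = subdivision f (a, b) t"
  have sub: "is_subdivision Ys (box_set (a, b))"
    unfolding Ys_def by (rule is_subdivision_subdivision[OF assms(1)])
  have small: "(\<Sum>i\<in>UNIV. alpha f (Ys ! k) i * ((snd (Ys ! k) $ i - fst (Ys ! k) $ i) / 2)^2) \<le> \<epsilon>"
    if "k \<in> M2 f Ys" for k
  proof -
    have k: "k < length Ys" "lambda_tilde f (Ys ! k) < 0"
      using that by (auto simp: M2_def)
    have "is_box (Ys ! k)" "box_set (Ys ! k) \<subseteq> box_set (a, b)"
      using sub k(1) by (auto simp: is_subdivision_def)
    moreover have "Ys ! k \<in> set (subdivision f (a, b) t)"
      using k(1) by (simp add: Ys_def)
    ultimately show ?thesis
      using sum_alpha_le[OF _ cont, of "Ys ! k" C \<delta>] hess t k(2) \<delta>(2) by auto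
  qed
  \<comment> \<open>Finiteness reduces \<open>Max\<close> to its members; for empty
    \<open>M2\<close> the value is 0, below \<epsilon>.\<close>
  have "finite (M2 f Ys)"
    by (simp add: M2_def)
  then have "Max_or_0 ((\<lambda>k. \<Sum>i\<in>UNIV. alpha f (Ys ! k) i *
      ((snd (Ys ! k) $ i - fst (Ys ! k) $ i) / 2)^2) ` M2 f Ys) \<le> \<epsilon>"
    using small assms(4) by (auto simp: Max_or_0_def)
  then show ?thesis
    using sub X_op_subset_X_ap[OF sub small] Ys_def by blast
qed

end
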